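(* Let $D\subseteq\mathbb{N}$ be a noncomputable computably enumerable set. Then there exists a computable structure $\mathcal{A}$ that is computably categorical relative to $D$ but is not computably categorical. That is, any two $D$-computable copies of $\mathcal{A}$ are isomorphic via a $D$-computable isomorphism, but there exist two computable copies of $\mathcal{A}$ between which there is no computable isomorphism.
   Context: All structures are countable structures in a computable language. For a set $X\subseteq\mathbb{N}$, a structure is $X$-computable if its domain is a subset of $\mathbb{N}$ computable from $X$ and its relations, functions and constants are uniformly computable from $X$; it is computable if it is $\emptyset$-computable. An ($X$-)computable copy of a structure $\mathcal{A}$ is an ($X$-)computable structure isomorphic to $\mathcal{A}$. A computable structure $\mathcal{A}$ is computably categorical if between any two computable copies of $\mathcal{A}$ there is a computable isomorphism. For $X\subseteq\mathbb{N}$, a computable structure $\mathcal{A}$ is computably categorical relative to $X$ if between any two $X$-computable copies of $\mathcal{A}$ there is an $X$-computable isomorphism. *)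

theory Defs
  imports "HOL-Library.Nat_Bijection"
begin

text \<open>
  Oracle computability is given by Kleene's schemata, formulated for unary partial functions
  on the naturals, with several arguments passed through the pairing bijection
  \<^const>\<open>prod_encode\<close>. The schema \<open>Oracle\<close> is the characteristic function of the oracle set.
\<close>

datatype program =
    Zero | Succ | Left | Right | Oracle
  | Pairing program program
  | Comp program program
  | Prim_Rec program program
  | Minimize program

primrec run :: "nat set \<Rightarrow> program \<Rightarrow> nat \<Rightarrow> nat option" where
  "run X Zero n = Some 0"
| "run X Succ n = Some (Suc n)"
| "run X Left n = Some (fst (prod_decode n))"
| "run X Right n = Some (snd (prod_decode n))"
| "run X Oracle n = Some (if n \<in> X then 1 else 0)"
| "run X (Pairing p q) n =
     Option.bind (run X p n) (\<lambda>u. Option.bind (run X q n) (\<lambda>v. Some (prod_encode (u, v))))"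
| "run X (Comp p q) n = Option.bind (run X q n) (run X p)"
| "run X (Prim_Rec p q) n =
     (case prod_decode n of (a, k) \<Rightarrow>
        rec_nat (run X p a)
          (\<lambda>i r. Option.bind r (\<lambda>v. run X q (prod_encode (a, prod_encode (i, v))))) k)"
| "run X (Minimize p) n =
     (if \<exists>k. run X p (prod_encode (n, k)) = Some 0 \<and>
             (\<forall>j<k. run X p (prod_encode (n, j)) \<noteq> None)
      then Some (LEAST k. run X p (prod_encode (n, k)) = Some 0)
      else None)"

definition computable_on :: "nat set \<Rightarrow> nat set \<Rightarrow> (nat \<Rightarrow> nat) \<Rightarrow> bool" where
  "computable_on X S f \<longleftrightarrow> (\<exists>p. \<forall>n\<in>S. run X p n = Some (f n))"

definition computable_set :: "nat set \<Rightarrow> nat set \<Rightarrow> bool" where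
  "computable_set X S \<longleftrightarrow> computable_on X UNIV (\<lambda>n. if n \<in> S then 1 else 0)"

definition computably_enumerable :: "nat set \<Rightarrow> bool" where
  "computably_enumerable S \<longleftrightarrow> (\<exists>p. S = {n. run {} p n \<noteq> None})"

text \<open>
  Symbols are natural numbers; relation and function symbols are numbered separately.
  Constants are the function symbols of arity 0.
\<close>

record language =
  rel_syms :: "nat set"
  rel_arity :: "nat \<Rightarrow> nat"
  fun_syms :: "nat set"
  fun_arity :: "nat \<Rightarrow> nat"

definition computable_language :: "language \<Rightarrow> bool" where
  "computable_language L \<longleftrightarrow>
     computable_set {} (rel_syms L) \<and> computable_on {} (rel_syms L) (rel_arity L) \<and>
     computable_set {} (fun_syms L) \<and> computable_on {} (fun_syms L) (fun_arity L)"

text \<open>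
  The interpretations are total HOL functions; their values are meaningful only at symbols of
  the language and at tuples of the right length over the universe, and every definition below
  looks only at those.
\<close>

record nat_structure =
  universe :: "nat set"
  rel_interp :: "nat \<Rightarrow> nat list \<Rightarrow> bool"
  fun_interp :: "nat \<Rightarrow> nat list \<Rightarrow> nat"

definition tuples :: "nat_structure \<Rightarrow> nat \<Rightarrow> nat list set" where
  "tuples A k = {xs. length xs = k \<and> set xs \<subseteq> universe A}"

definition is_structure :: "language \<Rightarrow> nat_structure \<Rightarrow> bool" where
  "is_structure L A \<longleftrightarrow>
     universe A \<noteq> {} \<and>
     (\<forall>g\<in>fun_syms L. \<forall>xs\<in>tuples A (fun_arity L g). fun_interp A g xs \<in> universe A)"

text \<open>
  Uniformity means that one program handles all relation symbols, and one program all function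
  symbols, receiving the symbol as part of the input.
\<close>

definition computable_structure :: "nat set \<Rightarrow> language \<Rightarrow> nat_structure \<Rightarrow> bool" where
  "computable_structure X L A \<longleftrightarrow>
     is_structure L A \<and>
     computable_set X (universe A) \<and>
     (\<exists>p. \<forall>r\<in>rel_syms L. \<forall>xs\<in>tuples A (rel_arity L r).
        run X p (prod_encode (r, list_encode xs)) = Some (if rel_interp A r xs then 1 else 0)) \<and>
     (\<exists>p. \<forall>g\<in>fun_syms L. \<forall>xs\<in>tuples A (fun_arity L g).
        run X p (prod_encode (g, list_encode xs)) = Some (fun_interp A g xs))"

definition isomorphism :: "language \<Rightarrow> nat_structure \<Rightarrow> nat_structure \<Rightarrow> (nat \<Rightarrow> nat) \<Rightarrow> bool" where
  "isomorphism L A B f \<longleftrightarrow>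
     bij_betw f (universe A) (universe B) \<and>
     (\<forall>r\<in>rel_syms L. \<forall>xs\<in>tuples A (rel_arity L r).
        rel_interp A r xs \<longleftrightarrow> rel_interp B r (map f xs)) \<and>
     (\<forall>g\<in>fun_syms L. \<forall>xs\<in>tuples A (fun_arity L g).
        f (fun_interp A g xs) = fun_interp B g (map f xs))"

definition computable_copy :: "nat set \<Rightarrow> language \<Rightarrow> nat_structure \<Rightarrow> nat_structure \<Rightarrow> bool" where
  "computable_copy X L A B \<longleftrightarrow> computable_structure X L B \<and> (\<exists>f. isomorphism L A B f)"

text \<open>The next two notions are intended for structures \<open>A\<close> that are computable (without oracle).\<close>

definition computably_categorical_relative ::
    "nat set \<Rightarrow> language \<Rightarrow> nat_structure \<Rightarrow> bool" where
  "computably_categorical_relative X L A \<longleftrightarrow>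
     (\<forall>B C. computable_copy X L A B \<and> computable_copy X L A C \<longrightarrow>
        (\<exists>f. isomorphism L B C f \<and> computable_on X (universe B) f))"

definition computably_categorical :: "language \<Rightarrow> nat_structure \<Rightarrow> bool" where
  "computably_categorical L A \<longleftrightarrow>
     (\<forall>B C. computable_copy {} L A B \<and> computable_copy {} L A C \<longrightarrow>
        (\<exists>f. isomorphism L B C f \<and> computable_on {} (universe B) f))"

end

theory Submission
  imports Defs
begin

text \<open>
  The structure consists of pairs of elements, infinitely many for each number \<open>n\<close>; the two elements
  of a pair for \<open>n\<close> look alike until \<open>n\<close> enters \<open>D\<close>, when one of them is marked. Marks are given by
  infinitely many unary relations, one for each pair and stage, so the structure is computable.
  An oracle for \<open>D\<close> tells whether a pair will ever be marked, hence how to match it. In a second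
  computable copy, the mark in the pair \<open>(e, n)\<close> is placed, when \<open>n\<close> enters \<open>D\<close>, so that it
  contradicts the value of the \<open>e\<close>-th partial computable function, provided that value has already
  been computed. A computable isomorphism onto this copy must therefore take longer to converge than
  \<open>n\<close> takes to enter \<open>D\<close>, which makes \<open>D\<close> computable.
\<close>

section \<open>Closure properties of the computable functions\<close>

abbreviation pfst :: "nat \<Rightarrow> nat" where "pfst z \<equiv> fst (prod_decode z)"
abbreviation psnd :: "nat \<Rightarrow> nat" where "psnd z \<equiv> snd (prod_decode z)"

abbreviation computable :: "nat set \<Rightarrow> (nat \<Rightarrow> nat) \<Rightarrow> bool" where
  "computable X \<equiv> computable_on X UNIV"

definition decidable :: "nat set \<Rightarrow> (nat \<Rightarrow> bool) \<Rightarrow> bool" where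
  "decidable X P \<longleftrightarrow> computable X (\<lambda>x. if P x then 1 else 0)"

lemma computable_set_decidable: "computable_set X S \<longleftrightarrow> decidable X (\<lambda>x. x \<in> S)"
  by (simp add: computable_set_def decidable_def)

lemma computable_on_compose:
  assumes "computable_on X T f" "computable_on X S g" "g ` S \<subseteq> T"
  shows "computable_on X S (\<lambda>x. f (g x))"
proof -
  obtain p q where "\<forall>n\<in>T. run X p n = Some (f n)" "\<forall>n\<in>S. run X q n = Some (g n)"
    using assms(1,2) unfolding computable_on_def by blast
  then have "\<forall>n\<in>S. run X (Comp p q) n = Some (f (g n))"
    using assms(3) by auto
  then show ?thesis unfolding computable_on_def by blast
qed

lemma computable_compose:
  "computable X f \<Longrightarrow> computable X g \<Longrightarrow> computable X (\<lambda>x. f (g x))"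
  by (rule computable_on_compose) auto

lemma decidable_compose: "decidable X P \<Longrightarrow> computable X g \<Longrightarrow> decidable X (\<lambda>x. P (g x))"
  unfolding decidable_def by (rule computable_compose)

lemma computable_Pair:
  assumes "computable X f" "computable X g"
  shows "computable X (\<lambda>x. prod_encode (f x, g x))"
proof -
  obtain p q where "\<forall>n. run X p n = Some (f n)" "\<forall>n. run X q n = Some (g n)"
    using assms unfolding computable_on_def by blast
  then have "\<forall>n. run X (Pairing p q) n = Some (prod_encode (f n, g n))" by simp
  then show ?thesis unfolding computable_on_def by blast
qed

lemma computable_Suc_raw: "computable X Suc"
  unfolding computable_on_def by (rule exI[of _ Succ]) simp

lemma computable_pfst_raw: "computable X pfst"
  unfolding computable_on_def by (rule exI[of _ Left]) simp

lemma computable_psnd_raw: "computable X psnd"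
  unfolding computable_on_def by (rule exI[of _ Right]) simp

lemmas computable_Suc = computable_compose[OF computable_Suc_raw]
lemmas computable_pfst = computable_compose[OF computable_pfst_raw]
lemmas computable_psnd = computable_compose[OF computable_psnd_raw]

lemma computable_id: "computable X (\<lambda>x. x)"
  unfolding computable_on_def by (rule exI[of _ "Pairing Left Right"]) simp

lemma computable_const: "computable X (\<lambda>x. c)"
proof (induction c)
  case 0
  show ?case unfolding computable_on_def by (rule exI[of _ Zero]) simp
next
  case (Suc c)
  then show ?case by (rule computable_Suc)
qed

lemma decidable_oracle: "decidable X (\<lambda>x. x \<in> X)"
  unfolding decidable_def computable_on_def by (rule exI[of _ Oracle]) simp

text \<open>Programs are unary, so the step function enters in uncurried form.
  \<open>Prim_Rec\<close> is applied to the pair of \<open>x\<close> and \<open>k x\<close>, which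
  lets \<open>x\<close> serve as the parameter of the recursion.\<close>

lemma computable_rec_nat:
  assumes "computable X g" "computable X k"
    and "computable X (\<lambda>z. h (pfst z) (pfst (psnd z)) (psnd (psnd z)))"
  shows "computable X (\<lambda>x. rec_nat (g x) (h x) (k x))"
proof -
  obtain p q where p: "\<And>n. run X p n = Some (g n)"
    and q: "\<And>z. run X q z = Some (h (pfst z) (pfst (psnd z)) (psnd (psnd z)))"
    using assms(1,3) unfolding computable_on_def by blast
  have "run X (Prim_Rec p q) (prod_encode (a, i)) = Some (rec_nat (g a) (h a) i)" for a i
    by (induction i) (simp_all add: p q)
  then have "computable X (\<lambda>z. rec_nat (g (pfst z)) (h (pfst z)) (psnd z))"
    unfolding computable_on_def by (metis prod.collapse prod_decode_inverse)
  from computable_compose[OF this computable_Pair[OF computable_id assms(2)]]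
  show ?thesis by simp
qed

lemma computable_on_Least:
  assumes "decidable X (\<lambda>z. P (pfst z) (psnd z))" "\<And>x. x \<in> S \<Longrightarrow> \<exists>i. P x i"
  shows "computable_on X S (\<lambda>x. LEAST i. P x i)"
proof -
  \<comment> \<open>\<open>Minimize\<close> looks for the value 0, so the truth values 1 and 0 are
    exchanged first.\<close>
  have "computable X (\<lambda>z. rec_nat 1 (\<lambda>_ _. 0) (if P (pfst z) (psnd z) then 1 else 0))"
    by (intro computable_rec_nat computable_const assms(1)[unfolded decidable_def])
  then obtain p where "\<And>z. run X p z = Some (if P (pfst z) (psnd z) then 0 else 1)"
    unfolding computable_on_def by (auto simp: if_distrib cong: if_cong)
  then have "run X (Minimize p) x = Some (LEAST i. P x i)" if "x \<in> S" for x
    using assms(2)[OF that] by simp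
  then show ?thesis unfolding computable_on_def by blast
qed

lemma computable_Least:
  assumes "decidable X (\<lambda>z. P (pfst z) (psnd z))" "\<And>x. \<exists>i. P x i"
  shows "computable X (\<lambda>x. LEAST i. P x i)"
  using assms by (intro computable_on_Least)

lemma computable_if:
  assumes "decidable X P" "computable X f" "computable X g"
  shows "computable X (\<lambda>x. if P x then f x else g x)"
proof -
  \<comment> \<open>A case distinction is a recursion of length 0 or 1 that starts with the negative
    branch.\<close>
  have "computable X (\<lambda>x. rec_nat (g x) (\<lambda>_ _. f x) (if P x then 1 else 0))"
    by (intro computable_rec_nat computable_compose[OF assms(2)] computable_pfst computable_id
        assms(3) assms(1)[unfolded decidable_def])
  then show ?thesis by (simp add: if_distrib cong: if_cong)
qed

section \<open>Connectives, arithmetic and bounded quantifiers\<close>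

lemma decidable_const: "decidable X (\<lambda>x. c)"
  by (simp add: decidable_def computable_const)

lemma decidable_not:
  assumes "decidable X P"
  shows "decidable X (\<lambda>x. \<not> P x)"
proof -
  have "computable X (\<lambda>x. if P x then 0 else 1)"
    using assms by (intro computable_if computable_const)
  moreover have "(if P x then 0 else 1) = (if \<not> P x then 1 else 0 :: nat)" for x by simp
  ultimately show ?thesis by (simp only: decidable_def)
qed

lemma decidable_conj:
  assumes "decidable X P" "decidable X Q"
  shows "decidable X (\<lambda>x. P x \<and> Q x)"
proof -
  have "computable X (\<lambda>x. if P x then if Q x then 1 else 0 else 0)"
    using assms by (intro computable_if computable_const)
  moreover have "(if P x then if Q x then 1 else 0 else 0) = (if P x \<and> Q x then 1 else 0 :: nat)" for x
    by simp
  ultimately show ?thesis by (simp only: decidable_def)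
qed

lemma decidable_disj: "decidable X P \<Longrightarrow> decidable X Q \<Longrightarrow> decidable X (\<lambda>x. P x \<or> Q x)"
  using decidable_not[OF decidable_conj[OF decidable_not decidable_not], of X P Q] by simp

lemma decidable_imp: "decidable X P \<Longrightarrow> decidable X Q \<Longrightarrow> decidable X (\<lambda>x. P x \<longrightarrow> Q x)"
  using decidable_disj[OF decidable_not, of X P Q] by simp

lemma computable_add:
  assumes "computable X f" "computable X g"
  shows "computable X (\<lambda>x. f x + g x)"
proof -
  have "computable X (\<lambda>x. rec_nat (f x) (\<lambda>_ r. Suc r) (g x))"
    using assms by (intro computable_rec_nat computable_Suc computable_psnd computable_id)
  moreover have "rec_nat a (\<lambda>_ r. Suc r) b = a + b" for a b by (induction b) auto
  ultimately show ?thesis by simp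
qed

lemma computable_pred:
  assumes "computable X f"
  shows "computable X (\<lambda>x. f x - 1)"
proof -
  have "computable X (\<lambda>x. rec_nat 0 (\<lambda>i _. i) (f x))"
    using assms
    by (intro computable_rec_nat computable_pfst computable_psnd computable_id computable_const)
  moreover have "rec_nat 0 (\<lambda>i _. i) b = b - 1" for b by (cases b) auto
  ultimately show ?thesis by simp
qed

lemma computable_diff:
  assumes "computable X f" "computable X g"
  shows "computable X (\<lambda>x. f x - g x)"
proof -
  have "computable X (\<lambda>x. rec_nat (f x) (\<lambda>_ r. r - 1) (g x))"
    using assms by (intro computable_rec_nat computable_pred computable_psnd computable_id)
  moreover have "rec_nat a (\<lambda>_ r. r - 1) b = a - b" for a b :: nat by (induction b) auto
  ultimately show ?thesis by simp
qed

lemma decidable_le: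
  assumes "computable X f" "computable X g"
  shows "decidable X (\<lambda>x. f x \<le> g x)"
proof -
  have "computable X (\<lambda>x. rec_nat 1 (\<lambda>_ _. 0) (f x - g x))"
    using assms by (intro computable_rec_nat computable_const computable_diff)
  moreover have "rec_nat 1 (\<lambda>_ _. 0) (a - b) = (if a \<le> b then 1 else 0 :: nat)" for a b :: nat
    by (cases "a - b") auto
  ultimately show ?thesis by (simp only: decidable_def)
qed

lemma decidable_less:
  assumes "computable X f" "computable X g"
  shows "decidable X (\<lambda>x. f x < g x)"
  using decidable_le[OF computable_Suc[OF assms(1)] assms(2)] by (simp add: Suc_le_eq)

lemma decidable_eq:
  assumes "computable X f" "computable X g"
  shows "decidable X (\<lambda>x. f x = g x)"
  using decidable_conj[OF decidable_le[OF assms] decidable_le[OF assms(2,1)]]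
  by (simp add: order.eq_iff)

lemma decidable_bex:
  assumes "computable X b" "decidable X (\<lambda>z. P (pfst z) (psnd z))"
  shows "decidable X (\<lambda>x. \<exists>i<b x. P x i)"
proof -
  \<comment> \<open>Stopping at the bound makes the search total; a witness exists exactly if the
    search stops before the bound.\<close>
  have "computable X (\<lambda>x. LEAST i. P x i \<or> b x \<le> i)"
    by (intro computable_Least decidable_disj assms decidable_le computable_compose[OF assms(1)]
        computable_pfst computable_psnd computable_id) auto
  from decidable_less[OF this assms(1)]
  have "decidable X (\<lambda>x. (LEAST i. P x i \<or> b x \<le> i) < b x)" .
  moreover have "(LEAST i. P x i \<or> b x \<le> i) < b x \<longleftrightarrow> (\<exists>i<b x. P x i)" for x
  proof
    assume *: "(LEAST i. P x i \<or> b x \<le> i) < b x"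
    have "P x (LEAST i. P x i \<or> b x \<le> i) \<or> b x \<le> (LEAST i. P x i \<or> b x \<le> i)"
      by (rule LeastI[of "\<lambda>i. P x i \<or> b x \<le> i" "b x"]) simp
    with * show "\<exists>i<b x. P x i" by auto
  next
    assume "\<exists>i<b x. P x i"
    then obtain i where "i < b x" "P x i" by blast
    then show "(LEAST i. P x i \<or> b x \<le> i) < b x"
      using Least_le[of "\<lambda>i. P x i \<or> b x \<le> i" i] by linarith
  qed
  ultimately show ?thesis by simp
qed

lemma decidable_ball:
  assumes "computable X b" "decidable X (\<lambda>z. P (pfst z) (psnd z))"
  shows "decidable X (\<lambda>x. \<forall>i<b x. P x i)"
  using decidable_not[OF decidable_bex[OF assms(1) decidable_not[OF assms(2)]]] by simp

lemma computable_half: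
  assumes "computable X f"
  shows "computable X (\<lambda>x. f x div 2)"
proof -
  have "computable X (\<lambda>x. LEAST i. f x < i + i + 2)"
    by (intro computable_Least decidable_less computable_add computable_compose[OF assms]
        computable_pfst computable_psnd computable_id computable_const) presburger
  moreover have "(LEAST i. a < i + i + 2) = a div 2" for a :: nat
    by (rule Least_equality) presburger+
  ultimately show ?thesis by simp
qed

lemma decidable_set_decode:
  assumes "computable X f" "computable X g"
  shows "decidable X (\<lambda>x. f x \<in> set_decode (g x))"
proof -
  \<comment> \<open>Bit \<open>f x\<close> of \<open>g x\<close> is the parity of \<open>g x\<close>
    after \<open>f x\<close> halvings.\<close>
  let ?h = "\<lambda>x. rec_nat (g x) (\<lambda>_ r. r div 2) (f x)"
  have "computable X ?h"
    using assms by (intro computable_rec_nat computable_half computable_psnd computable_id)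
  then have "decidable X (\<lambda>x. \<not> ?h x = ?h x div 2 + ?h x div 2)"
    by (intro decidable_not decidable_eq computable_add computable_half)
  moreover have "rec_nat a (\<lambda>_ r. r div 2) b = a div 2 ^ b" for a b :: nat
    by (induction b) (auto simp: div_mult2_eq[symmetric] mult.commute)
  moreover have "odd n \<longleftrightarrow> \<not> n = n div 2 + n div 2" for n :: nat by presburger
  ultimately show ?thesis by (simp add: set_decode_def)
qed

lemmas computable_intros =
  computable_Pair computable_Suc computable_pfst computable_psnd computable_id computable_const
  computable_if computable_add computable_pred computable_diff computable_half
  decidable_const decidable_not decidable_conj decidable_disj decidable_imp decidable_le
  decidable_less decidable_eq decidable_bex decidable_ball decidable_set_decode

section \<open>A universal function\<close>

text \<open>
  A derivation is a finite set of judgements \<open>(e, n, v)\<close>, read as ``the program with code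
  \<open>e\<close> maps \<open>n\<close> to \<open>v\<close>'', each of which follows from others in the set by one of the schemata.
  Premises always concern a proper subprogram, or the same primitive recursion at a smaller
  argument, so a set closed under justification is sound without any ordering of its elements.
\<close>

primrec code :: "program \<Rightarrow> nat" where
  "code Zero = prod_encode (0, 0)"
| "code Succ = prod_encode (1, 0)"
| "code Left = prod_encode (2, 0)"
| "code Right = prod_encode (3, 0)"
| "code Oracle = prod_encode (4, 0)"
| "code (Pairing p q) = prod_encode (5, prod_encode (code p, code q))"
| "code (Comp p q) = prod_encode (6, prod_encode (code p, code q))"
| "code (Prim_Rec p q) = prod_encode (7, prod_encode (code p, code q))"
| "code (Minimize p) = prod_encode (8, code p)"

definition judgement :: "nat \<Rightarrow> nat \<Rightarrow> nat \<Rightarrow> nat" where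
  "judgement e n v = prod_encode (e, prod_encode (n, v))"

text \<open>The tag \<open>pfst e\<close> selects the schema. Tag 4 is the oracle, whose answer is
  always 0 because only the empty oracle is simulated. Under tag 8, earlier values are required to
  be successors, which makes them both defined and nonzero.\<close>

definition justified :: "nat set \<Rightarrow> nat \<Rightarrow> nat \<Rightarrow> nat \<Rightarrow> bool" where
  "justified S e n v \<longleftrightarrow>
     pfst e = 0 \<and> v = 0 \<or>
     pfst e = 1 \<and> v = Suc n \<or>
     pfst e = 2 \<and> v = pfst n \<or>
     pfst e = 3 \<and> v = psnd n \<or>
     pfst e = 4 \<and> v = 0 \<or>
     pfst e = 5 \<and> judgement (pfst (psnd e)) n (pfst v) \<in> S \<and>
       judgement (psnd (psnd e)) n (psnd v) \<in> S \<or>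
     pfst e = 6 \<and>
       (\<exists>u. judgement (psnd (psnd e)) n u \<in> S \<and> judgement (pfst (psnd e)) u v \<in> S) \<or>
     pfst e = 7 \<and> psnd n = 0 \<and> judgement (pfst (psnd e)) (pfst n) v \<in> S \<or>
     pfst e = 7 \<and> \<not> psnd n = 0 \<and>
       (\<exists>u. judgement e (prod_encode (pfst n, psnd n - 1)) u \<in> S \<and>
          judgement (psnd (psnd e)) (prod_encode (pfst n, prod_encode (psnd n - 1, u))) v \<in> S) \<or>
     pfst e = 8 \<and> judgement (psnd e) (prod_encode (n, v)) 0 \<in> S \<and>
       (\<forall>j<v. \<exists>u. judgement (psnd e) (prod_encode (n, j)) (Suc u) \<in> S)"

definition derivation :: "nat set \<Rightarrow> bool" where
  "derivation S \<longleftrightarrow> (\<forall>e n v. judgement e n v \<in> S \<longrightarrow> justified S e n v)"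

lemma derivationD: "derivation S \<Longrightarrow> judgement e n v \<in> S \<Longrightarrow> justified S e n v"
  by (simp add: derivation_def)

lemma judgement_inject [simp]: "judgement e n v = judgement e' n' v' \<longleftrightarrow> e = e' \<and> n = n' \<and> v = v'"
  by (simp add: judgement_def)

text \<open>Membership in the set occurs only positively in \<open>justified\<close>; the proof
  descends through the connectives to these atoms.\<close>

lemma justified_mono:
  assumes "justified S e n v" "S \<subseteq> T"
  shows "justified T e n v"
  using assms(1) unfolding justified_def
  by (elim disj_forward conj_forward ex_forward all_forward imp_forward)
    (assumption | erule subsetD[OF assms(2)])+

lemma derivation_Union: "(\<And>S. S \<in> F \<Longrightarrow> derivation S) \<Longrightarrow> derivation (\<Union>F)"
  unfolding derivation_def by (meson Union_iff Union_upper justified_mono)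

lemma derivation_Un: "derivation S \<Longrightarrow> derivation T \<Longrightarrow> derivation (S \<union> T)"
  using derivation_Union[of "{S, T}"] by auto

lemma derivation_insert:
  "derivation S \<Longrightarrow> justified S e n v \<Longrightarrow> derivation (insert (judgement e n v) S)"
  unfolding derivation_def by (metis insert_iff judgement_inject justified_mono subset_insertI)

lemma derivation_extend:
  "finite S \<Longrightarrow> derivation S \<Longrightarrow> justified S e n v \<Longrightarrow>
    \<exists>S. finite S \<and> derivation S \<and> judgement e n v \<in> S"
  using derivation_insert by (meson finite_insert insertI1)

text \<open>Induction on the program. A premise of a primitive recursion may concern the same
  program, so that case has an inner induction on the recursion argument.\<close>

lemma derivation_sound:
  "derivation S \<Longrightarrow> judgement (code p) n v \<in> S \<Longrightarrow> run {} p n = Some v"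
proof (induction p arbitrary: n v)
  case (Prim_Rec p q)
  obtain a k where n: "n = prod_encode (a, k)" by (metis prod_decode_inverse surj_pair)
  have "run {} (Prim_Rec p q) (prod_encode (a, k)) = Some v"
    if "judgement (code (Prim_Rec p q)) (prod_encode (a, k)) v \<in> S" for k v
    using that
  proof (induction k arbitrary: v)
    case 0
    then have "justified S (code (Prim_Rec p q)) (prod_encode (a, 0)) v"
      by (rule derivationD[OF Prim_Rec.prems(1)])
    then show ?case using Prim_Rec.IH(1) Prim_Rec.prems(1) by (simp add: justified_def)
  next
    case (Suc k)
    from Suc.prems have "justified S (code (Prim_Rec p q)) (prod_encode (a, Suc k)) v"
      by (rule derivationD[OF Prim_Rec.prems(1)])
    then obtain u where
      "judgement (code (Prim_Rec p q)) (prod_encode (a, k)) u \<in> S"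
      "judgement (code q) (prod_encode (a, prod_encode (k, u))) v \<in> S"
      by (auto simp: justified_def)
    with Suc.IH Prim_Rec.IH(2) Prim_Rec.prems(1) show ?case by fastforce
  qed
  then show ?case using Prim_Rec.prems(2) n by blast
next
  case (Minimize p)
  from Minimize.prems have "justified S (code (Minimize p)) n v" by (rule derivationD)
  then have J: "judgement (code p) (prod_encode (n, v)) 0 \<in> S"
    "\<forall>j<v. \<exists>u. judgement (code p) (prod_encode (n, j)) (Suc u) \<in> S"
    by (auto simp: justified_def)
  have 0: "run {} p (prod_encode (n, v)) = Some 0"
    using Minimize.IH[OF Minimize.prems(1) J(1)] .
  have S: "\<exists>u. run {} p (prod_encode (n, j)) = Some (Suc u)" if "j < v" for j
    using Minimize.IH[OF Minimize.prems(1)] J(2) that by blast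
  have "(LEAST k. run {} p (prod_encode (n, k)) = Some 0) = v"
    using 0 S by (intro Least_equality) (assumption, metis Zero_not_Suc linorder_not_less option.inject)
  moreover have "\<forall>j<v. run {} p (prod_encode (n, j)) \<noteq> None" using S by fastforce
  ultimately show ?case using 0 by auto
next
  case (Comp p q)
  from Comp.prems have "justified S (code (Comp p q)) n v" by (rule derivationD)
  with Comp show ?case by (fastforce simp: justified_def)
next
  case (Pairing p q)
  from Pairing.prems have "justified S (code (Pairing p q)) n v" by (rule derivationD)
  then have "judgement (code p) n (pfst v) \<in> S" "judgement (code q) n (psnd v) \<in> S"
    by (auto simp: justified_def)
  then show ?case using Pairing by simp
qed (drule (1) derivationD, simp add: justified_def)+

text \<open>The finite derivations of the premises are united and the conclusion is added.
  Finiteness matters because derivations will be coded by numbers.\<close>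

lemma derivation_complete:
  "run {} p n = Some v \<Longrightarrow> \<exists>S. finite S \<and> derivation S \<and> judgement (code p) n v \<in> S"
proof (induction p arbitrary: n v)
  case (Pairing p q)
  then obtain u1 u2 where u: "run {} p n = Some u1" "run {} q n = Some u2" "v = prod_encode (u1, u2)"
    by (auto split: bind_splits)
  then obtain S T where "finite S" "derivation S" "judgement (code p) n u1 \<in> S"
    "finite T" "derivation T" "judgement (code q) n u2 \<in> T"
    using Pairing.IH(1)[OF u(1)] Pairing.IH(2)[OF u(2)] by blast
  then show ?case unfolding u(3)
    by (intro derivation_extend[of "S \<union> T"] derivation_Un) (auto simp: justified_def)
next
  case (Comp p q)
  then obtain u where u: "run {} q n = Some u" "run {} p u = Some v"
    by (auto split: bind_splits)
  then obtain S T where "finite S" "derivation S" "judgement (code p) u v \<in> S"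
    "finite T" "derivation T" "judgement (code q) n u \<in> T"
    using Comp.IH(1)[OF u(2)] Comp.IH(2)[OF u(1)] by blast
  then show ?case
    by (intro derivation_extend[of "S \<union> T"] derivation_Un) (auto simp: justified_def)
next
  case (Prim_Rec p q)
  obtain a k where n: "n = prod_encode (a, k)" by (metis prod_decode_inverse surj_pair)
  have "\<exists>S. finite S \<and> derivation S \<and> judgement (code (Prim_Rec p q)) (prod_encode (a, k)) v \<in> S"
    if "run {} (Prim_Rec p q) (prod_encode (a, k)) = Some v" for k v
    using that
  proof (induction k arbitrary: v)
    case 0
    then obtain S where "finite S" "derivation S" "judgement (code p) a v \<in> S"
      using Prim_Rec.IH(1)[of a v] by auto
    then show ?case
      by (intro derivation_extend[of S]) (auto simp: justified_def)
  next
    case (Suc k)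
    then obtain u where u: "run {} (Prim_Rec p q) (prod_encode (a, k)) = Some u"
      "run {} q (prod_encode (a, prod_encode (k, u))) = Some v"
      by (auto split: bind_splits)
    obtain S where S: "finite S" "derivation S"
      "judgement (code (Prim_Rec p q)) (prod_encode (a, k)) u \<in> S"
      using Suc.IH[OF u(1)] by blast
    obtain T where T: "finite T" "derivation T"
      "judgement (code q) (prod_encode (a, prod_encode (k, u))) v \<in> T"
      using Prim_Rec.IH(2)[OF u(2)] by blast
    from S T show ?case
      by (intro derivation_extend[of "S \<union> T"] derivation_Un) (auto simp: justified_def)
  qed
  then show ?case using Prim_Rec.prems n by blast
next
  case (Minimize p)
  let ?P = "\<lambda>k. run {} p (prod_encode (n, k)) = Some 0"
  obtain k where k: "?P k" "\<forall>j<k. run {} p (prod_encode (n, j)) \<noteq> None"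
    and v: "v = (LEAST k. ?P k)"
    using Minimize.prems unfolding run.simps by (metis (lifting) option.distinct(1) option.inject)
  have 0: "?P v" unfolding v using k(1) by (rule LeastI)
  \<comment> \<open>The witness \<open>k\<close> need not be the value returned; this inequality
    carries definedness below \<open>k\<close> over to all arguments below \<open>v\<close>.\<close>
  have "v \<le> k" unfolding v using k(1) by (rule Least_le)
  have "\<exists>u. run {} p (prod_encode (n, j)) = Some (Suc u)" if "j < v" for j
  proof -
    have "\<not> ?P j" using that unfolding v by (rule not_less_Least)
    moreover have "run {} p (prod_encode (n, j)) \<noteq> None" using k(2) \<open>v \<le> k\<close> that by simp
    ultimately show ?thesis by (metis not0_implies_Suc option.exhaust)
  qed
  then have "\<forall>j. \<exists>u. j < v \<longrightarrow> run {} p (prod_encode (n, j)) = Some (Suc u)" by blast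
  from choice[OF this] obtain u
    where u: "\<And>j. j < v \<Longrightarrow> run {} p (prod_encode (n, j)) = Some (Suc (u j))" by blast
  \<comment> \<open>\<open>r\<close> lists the values of \<open>p\<close> up to and including the
    zero at \<open>v\<close>, so that one family of derivations supplies both kinds of
    premises.\<close>
  define r where "r j = (if j < v then Suc (u j) else 0)" for j
  have "run {} p (prod_encode (n, j)) = Some (r j)" if "j \<le> v" for j
    using that 0 u[of j] by (cases "j = v") (simp_all add: r_def)
  then have "\<forall>j. \<exists>S. j \<le> v \<longrightarrow>
      finite S \<and> derivation S \<and> judgement (code p) (prod_encode (n, j)) (r j) \<in> S"
    using Minimize.IH by blast
  from choice[OF this] obtain S
    where S: "\<And>j. j \<le> v \<Longrightarrow> finite (S j)" "\<And>j. j \<le> v \<Longrightarrow> derivation (S j)"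
      "\<And>j. j \<le> v \<Longrightarrow> judgement (code p) (prod_encode (n, j)) (r j) \<in> S j"
    by blast
  let ?S = "\<Union>(S ` {..v})"
  have r: "judgement (code p) (prod_encode (n, j)) (r j) \<in> ?S" if "j \<le> v" for j
    using S(3)[OF that] that by blast
  have der: "derivation ?S" using S(2) by (intro derivation_Union) auto
  have just: "justified ?S (code (Minimize p)) n v"
  proof -
    have "judgement (code p) (prod_encode (n, v)) 0 \<in> ?S" using r[of v] by (simp add: r_def)
    moreover have "\<forall>j<v. \<exists>u. judgement (code p) (prod_encode (n, j)) (Suc u) \<in> ?S"
      using r by (metis less_imp_le r_def)
    ultimately show ?thesis by (simp add: justified_def del: UN_iff)
  qed
  have "finite ?S" using S(1) by simp
  from derivation_extend[OF this der just] show ?case .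
\<comment> \<open>Atomic programs have no premises, so the empty derivation can be extended at
  once.\<close>
qed (rule derivation_extend[of "{}"]; simp add: justified_def derivation_def)+

section \<open>Decidability of derivations and convergence by stages\<close>

text \<open>If bit \<open>x\<close> of \<open>w\<close> is set, then
  \<open>x < 2 ^ x \<le> w\<close>.\<close>

lemma mem_set_decode_less: "x \<in> set_decode w \<Longrightarrow> x < w"
  by (metis div_less even_zero less_exp linorder_not_less mem_Collect_eq order_less_le_trans set_decode_def)

lemma judgement_ge: "v \<le> judgement e n v" "n \<le> judgement e n v" "e \<le> judgement e n v"
  unfolding judgement_def by (meson le_prod_encode_1 le_prod_encode_2 le_trans)+

lemma judgement_mem_less:
  assumes "judgement e n v \<in> set_decode w"
  shows "v < w" "n < w" "e < w"
  using mem_set_decode_less[OF assms] judgement_ge by (meson le_less_trans)+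

text \<open>Every component of a judgement in the set coded by \<open>w\<close> is below
  \<open>w\<close>, so the unbounded witnesses \<open>u\<close> can be bounded by \<open>w\<close>.
  In this form the condition is decidable.\<close>

lemma justified_set_decode:
  "justified (set_decode w) e n v \<longleftrightarrow>
     pfst e = 0 \<and> v = 0 \<or>
     pfst e = 1 \<and> v = Suc n \<or>
     pfst e = 2 \<and> v = pfst n \<or>
     pfst e = 3 \<and> v = psnd n \<or>
     pfst e = 4 \<and> v = 0 \<or>
     pfst e = 5 \<and> judgement (pfst (psnd e)) n (pfst v) \<in> set_decode w \<and>
       judgement (psnd (psnd e)) n (psnd v) \<in> set_decode w \<or>
     pfst e = 6 \<and>
       (\<exists>u<w. judgement (psnd (psnd e)) n u \<in> set_decode w \<and>
          judgement (pfst (psnd e)) u v \<in> set_decode w) \<or>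
     pfst e = 7 \<and> psnd n = 0 \<and> judgement (pfst (psnd e)) (pfst n) v \<in> set_decode w \<or>
     pfst e = 7 \<and> \<not> psnd n = 0 \<and>
       (\<exists>u<w. judgement e (prod_encode (pfst n, psnd n - 1)) u \<in> set_decode w \<and>
          judgement (psnd (psnd e)) (prod_encode (pfst n, prod_encode (psnd n - 1, u))) v
            \<in> set_decode w) \<or>
     pfst e = 8 \<and> judgement (psnd e) (prod_encode (n, v)) 0 \<in> set_decode w \<and>
       (\<forall>j<v. \<exists>u<w. judgement (psnd e) (prod_encode (n, j)) (Suc u) \<in> set_decode w)"
  unfolding justified_def
  by (intro arg_cong2[where f = "(\<or>)"] arg_cong2[where f = "(\<and>)"] refl)
    (blast dest: judgement_mem_less(1) judgement_mem_less(1)[THEN Suc_lessD])+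

lemma derivation_set_decode:
  "derivation (set_decode w) \<longleftrightarrow>
     (\<forall>e<w. \<forall>n<w. \<forall>v<w. judgement e n v \<in> set_decode w \<longrightarrow> justified (set_decode w) e n v)"
  unfolding derivation_def by (blast dest: judgement_mem_less)

lemma decidable_derivation:
  assumes "computable X f"
  shows "decidable X (\<lambda>x. derivation (set_decode (f x)))"
proof -
  have "decidable X (\<lambda>w. derivation (set_decode w))"
    unfolding derivation_set_decode justified_set_decode judgement_def
    by (intro computable_intros)
  then show ?thesis using assms by (rule decidable_compose)
qed

text \<open>Stages replace running time: by stage \<open>s\<close> all derivations with code below
  \<open>s\<close> have been inspected.\<close>

definition converges :: "nat \<Rightarrow> nat \<Rightarrow> nat \<Rightarrow> nat \<Rightarrow> bool" where
  "converges e n v s \<longleftrightarrow> (\<exists>w<s. derivation (set_decode w) \<and> judgement e n v \<in> set_decode w)"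

lemma decidable_converges:
  assumes "computable X f" "computable X g" "computable X h" "computable X k"
  shows "decidable X (\<lambda>x. converges (f x) (g x) (h x) (k x))"
  unfolding converges_def judgement_def
  by (intro computable_intros decidable_derivation assms(4)
      computable_compose[OF assms(1)] computable_compose[OF assms(2)] computable_compose[OF assms(3)])

lemma converges_mono: "converges e n v s \<Longrightarrow> s \<le> t \<Longrightarrow> converges e n v t"
  unfolding converges_def by (meson order.strict_trans2)

lemma converges_iff: "(\<exists>s. converges (code p) n v s) \<longleftrightarrow> run {} p n = Some v"
proof
  assume "run {} p n = Some v"
  then obtain S where S: "finite S" "derivation S" "judgement (code p) n v \<in> S"
    using derivation_complete by blast
  then have "set_decode (set_encode S) = S" by simp
  then have "converges (code p) n v (Suc (set_encode S))"
    unfolding converges_def using S by (metis lessI)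
  then show "\<exists>s. converges (code p) n v s" ..
next
  assume "\<exists>s. converges (code p) n v s"
  then show "run {} p n = Some v" unfolding converges_def using derivation_sound by blast
qed

text \<open>The output is a component of a judgement in a set coded below \<open>s\<close>. Hence a
  search for outputs seen by stage \<open>s\<close> can be bounded by \<open>s\<close>.\<close>

lemma converges_bounded: "converges e n v s \<Longrightarrow> v < s"
  unfolding converges_def by (meson judgement_mem_less order.strict_trans)

section \<open>Structures in a language of unary relations\<close>

definition unary_language :: language where
  "unary_language = \<lparr>rel_syms = UNIV, rel_arity = \<lambda>_. 1, fun_syms = {}, fun_arity = \<lambda>_. 0\<rparr>"

lemma unary_language_simps [simp]:
  "rel_syms unary_language = UNIV" "rel_arity unary_language r = 1"
  "fun_syms unary_language = {}"
  by (simp_all add: unary_language_def)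

lemma computable_unary_language: "computable_language unary_language"
  by (simp add: computable_language_def unary_language_def computable_set_decidable
      decidable_const computable_const computable_on_def[of _ "{}"])

lemma tuples_1: "tuples A 1 = (\<lambda>x. [x]) ` universe A"
  by (auto simp: tuples_def length_Suc_conv)

lemma isomorphism_unary_iff:
  "isomorphism unary_language A B f \<longleftrightarrow>
     bij_betw f (universe A) (universe B) \<and>
     (\<forall>r. \<forall>x\<in>universe A. rel_interp A r [x] \<longleftrightarrow> rel_interp B r [f x])"
  by (simp add: isomorphism_def tuples_1[unfolded One_nat_def])

lemma isomorphism_compose:
  assumes "isomorphism unary_language A B f" "isomorphism unary_language B C g"
  shows "isomorphism unary_language A C (\<lambda>x. g (f x))"
proof -
  have "bij_betw (g \<circ> f) (universe A) (universe C)"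
    using assms bij_betw_trans unfolding isomorphism_unary_iff by blast
  moreover have "f x \<in> universe B" if "x \<in> universe A" for x
    using assms(1) that unfolding isomorphism_unary_iff by (meson bij_betwE)
  ultimately show ?thesis using assms by (simp add: isomorphism_unary_iff comp_def)
qed

lemma isomorphism_inverse:
  assumes "isomorphism unary_language A B f"
    and "\<And>y. y \<in> universe B \<Longrightarrow> g y \<in> universe A \<and> f (g y) = y"
  shows "isomorphism unary_language B A g"
proof -
  have f: "bij_betw f (universe A) (universe B)"
    using assms(1) by (simp add: isomorphism_unary_iff)
  have "bij_betw g (universe B) (universe A)"
  proof (rule bij_betw_byWitness[where f' = f])
    show "\<forall>x\<in>universe A. g (f x) = x"
      using f assms(2) by (meson bij_betwE bij_betw_imp_inj_on inj_onD)
  qed (use f assms(2) in \<open>auto dest: bij_betwE\<close>)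
  then show ?thesis using assms by (simp add: isomorphism_unary_iff)
qed

text \<open>A relation symbol codes a pair number and a stage. Building in membership in the
  universe makes this decidable on all numbers, as searches through the structure require.\<close>

definition holds :: "nat_structure \<Rightarrow> nat \<Rightarrow> nat \<Rightarrow> nat \<Rightarrow> bool" where
  "holds A m s x \<longleftrightarrow> x \<in> universe A \<and> rel_interp A (prod_encode (m, s)) [x]"

text \<open>A program for \<open>Q\<close> may diverge where \<open>P\<close> fails. A recursion
  whose length is the truth value of \<open>P\<close> runs it only where \<open>P\<close>
  holds.\<close>

lemma decidable_guarded:
  assumes "decidable X P" "computable_on X {x. P x} (\<lambda>x. if Q x then 1 else 0)"
  shows "decidable X (\<lambda>x. P x \<and> Q x)"
proof -
  obtain p where p: "\<And>x. run X p x = Some (if P x then 1 else 0)"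
    using assms(1) unfolding decidable_def computable_on_def by blast
  obtain q where q: "\<And>x. P x \<Longrightarrow> run X q x = Some (if Q x then 1 else 0)"
    using assms(2) unfolding computable_on_def by blast
  obtain i where i: "\<And>x. run X i x = Some x"
    using computable_id[of X] unfolding computable_on_def by blast
  let ?r = "Comp (Prim_Rec Zero (Comp q Left)) (Pairing i p)"
  have "run X ?r x = Some (if P x \<and> Q x then 1 else 0)" for x
    using p[of x] q[of x] i[of x] by (cases "P x") simp_all
  then show ?thesis unfolding decidable_def computable_on_def by blast
qed

lemma decidable_holds:
  assumes "computable_structure X unary_language A"
    and "computable X f" "computable X g" "computable X h"
  shows "decidable X (\<lambda>x. holds A (f x) (g x) (h x))"
proof -
  let ?R = "\<lambda>z. rel_interp A (pfst z) [psnd z]"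
  obtain p where p: "\<And>r x. x \<in> universe A \<Longrightarrow>
      run X p (prod_encode (r, list_encode [x])) = Some (if rel_interp A r [x] then 1 else 0)"
    using assms(1) unfolding computable_structure_def unary_language_simps tuples_1
    by (meson UNIV_I image_eqI)
  have "computable X (\<lambda>z. prod_encode (pfst z, list_encode [psnd z]))"
    unfolding list_encode.simps by (intro computable_intros)
  then obtain q where "\<And>z. run X q z = Some (prod_encode (pfst z, list_encode [psnd z]))"
    unfolding computable_on_def by blast
  then have "run X (Comp p q) z = Some (if ?R z then 1 else 0)" if "psnd z \<in> universe A" for z
    using p[OF that] by simp
  then have "computable_on X {z. psnd z \<in> universe A} (\<lambda>z. if ?R z then 1 else 0)"
    unfolding computable_on_def by blast
  moreover have "decidable X (\<lambda>z. psnd z \<in> universe A)"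
    using assms(1) unfolding computable_structure_def computable_set_decidable
    by (intro decidable_compose[OF _ computable_psnd_raw]) simp
  ultimately have R: "decidable X (\<lambda>z. psnd z \<in> universe A \<and> ?R z)"
    by (intro decidable_guarded)
  have "computable X (\<lambda>x. prod_encode (prod_encode (f x, g x), h x))"
    by (intro computable_intros assms(2-))
  from decidable_compose[OF R this] show ?thesis by (simp add: holds_def)
qed

lemma holds_isomorphism:
  assumes "isomorphism unary_language A B f" "x \<in> universe A"
  shows "holds B m s (f x) \<longleftrightarrow> holds A m s x"
proof -
  have "f x \<in> universe B" using assms unfolding isomorphism_unary_iff by (meson bij_betwE)
  then show ?thesis using assms by (simp add: isomorphism_unary_iff holds_def)
qed

section \<open>Labelled pairs\<close>

text \<open>\<open>E n s\<close> is read as "\<open>n\<close> enters \<open>D\<close> at stage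
  \<open>s\<close>". Uniqueness of the stage means that each pair is marked at most once, and since
  nothing enters at stage 0, the relation for stage 0 identifies the whole pair.\<close>

locale enumeration =
  fixes D :: "nat set" and E :: "nat \<Rightarrow> nat \<Rightarrow> bool"
  assumes mem_iff: "n \<in> D \<longleftrightarrow> (\<exists>s. E n s)"
    and enters_unique: "E n s \<Longrightarrow> E n t \<Longrightarrow> s = t"
    and not_enters_0: "\<not> E n 0"
    and decidable_enters_raw: "decidable X (\<lambda>z. E (pfst z) (psnd z))"
begin

lemma decidable_enters:
  assumes "computable X f" "computable X g"
  shows "decidable X (\<lambda>x. E (f x) (g x))"
  using decidable_compose[OF decidable_enters_raw computable_Pair[OF assms]] by simp

text \<open>
  The elements \<open>2 m\<close> and \<open>2 m + 1\<close> form the \<open>m\<close>-th pair, which belongs to the number \<open>psnd m\<close>.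
\<close>

definition member :: "(nat \<Rightarrow> nat \<Rightarrow> bool) \<Rightarrow> nat \<Rightarrow> nat \<Rightarrow> nat \<Rightarrow> bool" where
  "member \<beta> m s x \<longleftrightarrow>
     x div 2 = m \<and> (E (psnd m) s \<longrightarrow> x = m + m + (if \<beta> m s then 1 else 0))"

text \<open>The parameter \<open>\<beta>\<close> chooses which element of pair \<open>m\<close>
  keeps the relation \<open>(m, s)\<close> when \<open>psnd m\<close> enters at \<open>s\<close>.
  Constant \<open>False\<close> gives the standard copy, where it is always the even one.\<close>

definition pairs :: "(nat \<Rightarrow> nat \<Rightarrow> bool) \<Rightarrow> nat_structure" where
  "pairs \<beta> =
     \<lparr>universe = UNIV,
      rel_interp = (\<lambda>r xs. member \<beta> (pfst r) (psnd r) (hd xs)),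
      fun_interp = (\<lambda>_ _. 0)\<rparr>"

lemma universe_pairs [simp]: "universe (pairs \<beta>) = UNIV"
  by (simp add: pairs_def)

lemma holds_pairs [simp]: "holds (pairs \<beta>) = member \<beta>"
  by (intro ext) (simp add: holds_def pairs_def)

lemma computable_pairs:
  assumes "decidable X (\<lambda>z. \<beta> (pfst z) (psnd z))"
  shows "computable_structure X unary_language (pairs \<beta>)"
proof -
  have \<beta>: "decidable X (\<lambda>x. \<beta> (f x) (g x))" if "computable X f" "computable X g" for f g
    using decidable_compose[OF assms computable_Pair[OF that]] by simp
  \<comment> \<open>The list \<open>[x]\<close> is coded as \<open>Suc (prod_encode (x, 0))\<close>,
    so \<open>x\<close> is recovered as \<open>pfst (psnd z - 1)\<close>.\<close>
  have "decidable X (\<lambda>z. member \<beta> (pfst (pfst z)) (psnd (pfst z)) (pfst (psnd z - 1)))"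
    unfolding member_def by (intro computable_intros decidable_enters \<beta>)
  then obtain p where p: "\<And>z. run X p z =
      Some (if member \<beta> (pfst (pfst z)) (psnd (pfst z)) (pfst (psnd z - 1)) then 1 else 0)"
    unfolding decidable_def computable_on_def by blast
  have "\<forall>r. \<forall>xs\<in>tuples (pairs \<beta>) 1.
      run X p (prod_encode (r, list_encode xs)) = Some (if rel_interp (pairs \<beta>) r xs then 1 else 0)"
    unfolding tuples_1 p by (auto simp: pairs_def)
  then have "\<exists>p. \<forall>r. \<forall>xs\<in>tuples (pairs \<beta>) 1.
      run X p (prod_encode (r, list_encode xs)) = Some (if rel_interp (pairs \<beta>) r xs then 1 else 0)"
    by (rule exI)
  then show ?thesis unfolding computable_structure_def is_structure_def
    by (simp only: unary_language_simps universe_pairs computable_set_decidable)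
      (simp add: decidable_const)
qed

section \<open>Isomorphisms that swap pairs\<close>

definition flip :: "nat set \<Rightarrow> nat \<Rightarrow> nat" where
  "flip S x = (if x div 2 \<in> S then if even x then x + 1 else x - 1 else x)"

lemma flip_div_2 [simp]: "flip S x div 2 = x div 2"
  by (auto simp: flip_def elim!: oddE)

lemma flip_flip [simp]: "flip S (flip S x) = x"
proof -
  have "even (flip S x) \<longleftrightarrow> (if x div 2 \<in> S then odd x else even x)"
    by (auto simp: flip_def)
  then show ?thesis using flip_div_2[of S x] by (auto simp: flip_def[of S "flip S x"]) (auto simp: flip_def)
qed

lemma flip_pair:
  "flip S (m + m) = m + m + (if m \<in> S then 1 else 0)"
  "flip S (m + m + 1) = m + m + (if m \<in> S then 0 else 1)"
proof -
  have "(m + m) div 2 = m" "(m + m + 1) div 2 = m" "even (m + m)" "odd (m + m + 1)" by presburger+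
  then show "flip S (m + m) = m + m + (if m \<in> S then 1 else 0)"
    "flip S (m + m + 1) = m + m + (if m \<in> S then 0 else 1)"
    unfolding flip_def by simp_all
qed

text \<open>The two elements of a pair are told apart only at the stage when its number enters.
  There the pair must be swapped exactly if the two structures choose differently; pairs that are
  never marked may be swapped freely.\<close>

lemma isomorphism_flip:
  assumes "\<And>m s. E (psnd m) s \<Longrightarrow> m \<in> S \<longleftrightarrow> \<beta> m s \<noteq> \<gamma> m s"
  shows "isomorphism unary_language (pairs \<beta>) (pairs \<gamma>) (flip S)"
proof -
  have "member \<beta> m s x \<longleftrightarrow> member \<gamma> m s (flip S x)" for m s x
  proof (cases "x div 2 = m \<and> E (psnd m) s")
    case True
    then have "m \<in> S \<longleftrightarrow> \<beta> m s \<noteq> \<gamma> m s" using assms by blast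
    moreover from True have "x div 2 = m" ..
    then have "x = m + m \<or> x = m + m + 1" by presburger
    ultimately show ?thesis using True flip_pair[of S m]
      unfolding member_def flip_div_2 by (auto split: if_splits)
  qed (auto simp: member_def)
  moreover have "bij (flip S)" by (rule o_bij[of "flip S"]) (auto simp: fun_eq_iff)
  ultimately show ?thesis by (simp add: isomorphism_unary_iff pairs_def)
qed

section \<open>Categoricity relative to the oracle\<close>

text \<open>
  With the oracle \<open>D\<close> one can compute for each \<open>m\<close> a stage at which the relation \<open>(m, s)\<close> is as
  small as possible: either \<open>psnd m\<close> enters then, or it never enters and the pair can be swapped.
\<close>

definition settled :: "nat \<Rightarrow> nat" where
  "settled n = (LEAST s. E n s \<or> n \<notin> D)"

lemma enters_settled: "n \<in> D \<Longrightarrow> E n (settled n)"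
  unfolding settled_def using LeastI_ex[of "\<lambda>s. E n s \<or> n \<notin> D"] mem_iff[of n] by auto

lemma computable_settled: "computable D settled"
proof -
  have "\<exists>s. E n s \<or> n \<notin> D" for n using mem_iff[of n] by auto
  then show ?thesis unfolding settled_def
    by (intro computable_Least computable_intros decidable_enters
        decidable_compose[OF decidable_oracle])
qed

text \<open>The given \<open>g\<close> need not be computable and serves only for verification: the
  map \<open>h\<close>, found by search with the oracle, is \<open>g\<close> preceded by swaps of
  pairs that are never marked.\<close>

lemma computable_isomorphism_from_pairs:
  assumes C: "computable_structure D unary_language C"
    and g: "isomorphism unary_language (pairs (\<lambda>_ _. False)) C g"
  obtains h where "isomorphism unary_language (pairs (\<lambda>_ _. False)) C h" "computable D h"
proof
  let ?\<beta> = "\<lambda>_ _. False"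
  let ?A = "pairs ?\<beta>"
  \<comment> \<open>If \<open>psnd m\<close> lies in \<open>D\<close>, the settled relation forces
    \<open>first m\<close> to be the image of \<open>m + m\<close>; otherwise either element will
    do. The stage 0 relation then finds its partner.\<close>
  define first where "first m = (LEAST y. holds C m (settled (psnd m)) y)" for m
  define second where "second m = (LEAST y. holds C m 0 y \<and> y \<noteq> first m)" for m
  define h where "h x = (if x = x div 2 + x div 2 then first (x div 2) else second (x div 2))" for x
  have g_bij: "bij_betw g UNIV (universe C)" using g by (simp add: isomorphism_unary_iff)
  then have g_eq: "g x = g y \<longleftrightarrow> x = y" for x y by (auto simp: bij_betw_def inj_eq)
  have holds_g: "holds C m s (g x) \<longleftrightarrow> member ?\<beta> m s x" for m s x
    using holds_isomorphism[OF g] by simp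
  have holds_ex: "\<exists>x. y = g x \<and> member ?\<beta> m s x" if "holds C m s y" for m s y
  proof -
    have "y \<in> range g" using g_bij that unfolding holds_def bij_betw_def by simp
    then show ?thesis using that holds_g by auto
  qed
  have half: "x div 2 = m \<longleftrightarrow> x = m + m \<or> x = m + m + 1" for x m :: nat by presburger
  have ex: "\<exists>y. holds C m s y" for m s
  proof -
    have "member ?\<beta> m s (m + m)" by (simp add: member_def)
    then show ?thesis using holds_g by blast
  qed
  have first: "holds C m (settled (psnd m)) (first m)" for m
    unfolding first_def using ex by (rule LeastI_ex)
  have first_cases: "first m = g (m + m) \<or> first m = g (m + m + 1)" for m
    using holds_ex[OF first[of m]] by (auto simp: member_def half)
  have ex2: "\<exists>y. holds C m 0 y \<and> y \<noteq> first m" for m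
  proof -
    have "holds C m 0 (g (m + m))" "holds C m 0 (g (m + m + 1))"
      by (simp_all add: holds_g member_def not_enters_0)
    moreover have "g (m + m) \<noteq> g (m + m + 1)" by (simp add: g_eq)
    ultimately show ?thesis by metis
  qed
  have second: "holds C m 0 (second m)" "second m \<noteq> first m" for m
    unfolding second_def using LeastI_ex[OF ex2[of m]] by simp_all
  have second_cases: "second m = g (m + m) \<or> second m = g (m + m + 1)" for m
    using holds_ex[OF second(1)[of m]] by (auto simp: member_def half)
  \<comment> \<open>The pairs on which \<open>h\<close> and \<open>g\<close> disagree.\<close>
  let ?S = "{m. first m \<noteq> g (m + m)}"
  have "h x = g (flip ?S x)" for x
  proof -
    define m where "m = x div 2"
    then consider "x = m + m" | "x = m + m + 1" using half by blast
    then show ?thesis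
    proof cases
      case 1
      then show ?thesis using first_cases[of m] flip_pair(1)[of ?S m] by (auto simp: h_def)
    next
      case 2
      then show ?thesis using first_cases[of m] second_cases[of m] second(2)[of m]
          flip_pair(2)[of ?S m] by (auto simp: h_def)
    qed
  qed
  then have h_eq: "h = (\<lambda>x. g (flip ?S x))" by blast
  have "isomorphism unary_language ?A ?A (flip ?S)"
  proof (rule isomorphism_flip)
    fix m s
    assume "E (psnd m) s"
    then have "E (psnd m) (settled (psnd m))" using enters_settled mem_iff by blast
    then have "first m = g (m + m)"
      using holds_ex[OF first[of m]] by (auto simp: member_def)
    then show "m \<in> ?S \<longleftrightarrow> False \<noteq> False" by simp
  qed
  from isomorphism_compose[OF this g] show "isomorphism unary_language ?A C h"
    unfolding h_eq .
  have first_D: "computable D first" unfolding first_def using ex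
    by (intro computable_Least decidable_holds[OF C] computable_intros
        computable_compose[OF computable_settled])
  have second_D: "computable D second" unfolding second_def using ex2
    by (intro computable_Least decidable_holds[OF C] computable_intros computable_compose[OF first_D])
  show "computable D h" unfolding h_def
    by (intro computable_intros computable_compose[OF first_D] computable_compose[OF second_D])
qed

text \<open>Two copies are compared through the standard one: the isomorphism onto the first is
  inverted by search and followed by the isomorphism onto the second.\<close>

lemma categorical_relative:
  "computably_categorical_relative D unary_language (pairs (\<lambda>_ _. False))"
  (is "computably_categorical_relative _ ?L ?A")
  unfolding computably_categorical_relative_def
proof (intro allI impI)
  have ex_iso: "\<exists>h. isomorphism ?L ?A B h \<and> computable D h" if copy: "computable_copy D ?L ?A B" for B
  proof -
    from copy obtain f where "computable_structure D ?L B" "isomorphism ?L ?A B f"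
      unfolding computable_copy_def by blast
    then obtain h where "isomorphism ?L ?A B h" "computable D h"
      by (rule computable_isomorphism_from_pairs)
    then show ?thesis by blast
  qed
  fix B C
  assume "computable_copy D ?L ?A B \<and> computable_copy D ?L ?A C"
  then obtain h k where h: "isomorphism ?L ?A B h" "computable D h"
    and k: "isomorphism ?L ?A C k" "computable D k"
    using ex_iso by blast
  \<comment> \<open>The search succeeds on the universe of \<open>B\<close>, where \<open>h\<close>
    is onto; hence \<open>g\<close> is only claimed to be computable there.\<close>
  define g where "g y = (LEAST x. h x = y)" for y
  have ex: "\<exists>x. h x = y" if "y \<in> universe B" for y
  proof -
    have "y \<in> range h" using h(1) that by (simp add: isomorphism_unary_iff bij_betw_def)
    then show ?thesis by auto
  qed
  have "h (g y) = y" if "y \<in> universe B" for y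
    unfolding g_def using ex[OF that] by (rule LeastI_ex)
  then have "isomorphism ?L B ?A g"
    by (intro isomorphism_inverse[OF h(1)]) simp
  then have "isomorphism ?L B C (\<lambda>y. k (g y))"
    using k(1) by (rule isomorphism_compose)
  moreover have "computable_on D (universe B) g" unfolding g_def using ex
    by (intro computable_on_Least computable_intros computable_compose[OF h(2)])
  then have "computable_on D (universe B) (\<lambda>y. k (g y))"
    by (intro computable_on_compose[OF k(2)]) auto
  ultimately show "\<exists>f. isomorphism ?L B C f \<and> computable_on D (universe B) f" by blast
qed

section \<open>Diagonalisation against computable isomorphisms\<close>

text \<open>Pair \<open>m\<close> is devoted to the program coded by \<open>pfst m\<close>. If that
  program has been seen to fix \<open>m + m\<close> by stage \<open>s\<close>, the surviving element
  becomes \<open>m + m + 1\<close>; otherwise it stays \<open>m + m\<close>. A value computed by the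
  entering stage is therefore wrong.\<close>

definition diagonal :: "nat \<Rightarrow> nat \<Rightarrow> bool" where
  "diagonal m s \<longleftrightarrow> converges (pfst m) (m + m) (m + m) s"

lemma decidable_diagonal: "decidable X (\<lambda>z. diagonal (pfst z) (psnd z))"
  unfolding diagonal_def by (intro decidable_converges computable_intros)

text \<open>The stage \<open>c n\<close> at which the value of \<open>f\<close> on the pair devoted
  to \<open>n\<close> is seen bounds the stage at which \<open>n\<close> can enter, so membership in
  \<open>D\<close> becomes a bounded search.\<close>

lemma decidable_if_computable_isomorphism:
  assumes f: "isomorphism unary_language (pairs (\<lambda>_ _. False)) (pairs diagonal) f"
    and "computable {} f"
  shows "decidable {} (\<lambda>n. n \<in> D)"
proof -
  obtain p where p: "\<And>x. run {} p x = Some (f x)"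
    using assms(2) unfolding computable_on_def by blast
  let ?e = "code p"
  \<comment> \<open>The even element of the pair numbered \<open>(?e, n)\<close>.\<close>
  let ?x = "\<lambda>n. prod_encode (?e, n) + prod_encode (?e, n)"
  define c where "c n = (LEAST t. \<exists>v<t. converges ?e (?x n) v t)" for n
  have ex: "\<exists>t. \<exists>v<t. converges ?e (?x n) v t" for n
    using converges_iff[of p] p converges_bounded by meson
  have c: "\<exists>v<c n. converges ?e (?x n) v (c n)" for n
    unfolding c_def using ex by (rule LeastI_ex)
  have "s < c n" if "E n s" for n s
  proof (rule ccontr)
    assume "\<not> s < c n"
    define m where "m = prod_encode (?e, n)"
    have m: "pfst m = ?e" "psnd m = n" by (simp_all add: m_def)
    obtain v where "converges ?e (m + m) v s"
      using c[of n] converges_mono \<open>\<not> s < c n\<close> unfolding m_def by (meson linorder_not_less)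
    then have conv: "converges ?e (m + m) (f (m + m)) s"
      using converges_iff[of p "m + m" v] p[of "m + m"] by auto
    have "member diagonal m s (f (m + m))"
      using holds_isomorphism[OF f, of "m + m" m s] by (simp add: member_def)
    then have fm: "f (m + m) = m + m + (if converges ?e (m + m) (m + m) s then 1 else 0)"
      using that by (simp add: member_def diagonal_def m)
    show False
    \<comment> \<open>Either the value is \<open>m + m\<close> and the copy demands
      \<open>m + m + 1\<close>, or the value differs from \<open>m + m\<close> and the copy demands
      \<open>m + m\<close>.\<close>
    proof (cases "converges ?e (m + m) (m + m) s")
      case True
      then have "f (m + m) = m + m"
        using converges_iff[of p "m + m" "m + m"] p[of "m + m"] by auto
      with True fm show False by simp
    next
      case False
      with conv fm show False by simp
    qed
  qed
  then have "n \<in> D \<longleftrightarrow> (\<exists>s<c n. E n s)" for n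
    using mem_iff by blast
  moreover have "computable {} c" unfolding c_def using ex
    by (intro computable_Least computable_intros decidable_converges)
  then have "decidable {} (\<lambda>n. \<exists>s<c n. E n s)"
    by (intro computable_intros decidable_enters)
  ultimately show ?thesis by simp
qed

lemma not_categorical:
  assumes "\<not> computable_set {} D"
  shows "\<not> computably_categorical unary_language (pairs (\<lambda>_ _. False))"
proof
  let ?A = "pairs (\<lambda>_ _. False)"
  assume cat: "computably_categorical unary_language ?A"
  have copy: "computable_copy {} unary_language ?A (pairs \<beta>)"
    if "decidable {} (\<lambda>z. \<beta> (pfst z) (psnd z))" for \<beta>
  proof -
    \<comment> \<open>The pairs whose mark is displaced by \<open>\<beta>\<close>; uniqueness of the
      entering stage makes this agree with \<open>\<beta>\<close> at that stage.\<close>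
    let ?S = "{m. \<exists>s. E (psnd m) s \<and> \<beta> m s}"
    have "isomorphism unary_language ?A (pairs \<beta>) (flip ?S)"
      by (rule isomorphism_flip) (use enters_unique in blast)
    then show ?thesis
      unfolding computable_copy_def using computable_pairs[OF that] by blast
  qed
  obtain f where "isomorphism unary_language ?A (pairs diagonal) f" "computable {} f"
    using cat copy[OF decidable_const] copy[OF decidable_diagonal]
    unfolding computably_categorical_def by (metis universe_pairs)
  with assms show False
    using decidable_if_computable_isomorphism computable_set_decidable by blast
qed

end

section \<open>Stagewise enumeration of a computably enumerable set\<close>

text \<open>A number enters at the first stage at which the semidecision program is seen to halt.
  Bounding the output by the stage keeps this decidable and rules out stage 0.\<close>

lemma computably_enumerable_enumeration:
  assumes "computably_enumerable D"
  obtains E where "enumeration D E"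
proof -
  obtain p where p: "D = {n. run {} p n \<noteq> None}"
    using assms unfolding computably_enumerable_def by blast
  define halted where "halted n s \<longleftrightarrow> (\<exists>v<s. converges (code p) n v s)" for n s
  define E where "E n s \<longleftrightarrow> halted n s \<and> (\<forall>t<s. \<not> halted n t)" for n s
  have halted: "n \<in> D \<longleftrightarrow> (\<exists>s. halted n s)" for n
  proof -
    have "n \<in> D \<longleftrightarrow> (\<exists>v s. converges (code p) n v s)"
      unfolding p converges_iff by auto
    also have "\<dots> \<longleftrightarrow> (\<exists>s. halted n s)"
      unfolding halted_def using converges_bounded by blast
    finally show ?thesis .
  qed
  have "enumeration D E"
  proof
    show "n \<in> D \<longleftrightarrow> (\<exists>s. E n s)" for n
      unfolding halted E_def using exists_least_iff[of "halted n"] by blast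
    show "E n s \<Longrightarrow> E n t \<Longrightarrow> s = t" for n s t
      unfolding E_def by (meson linorder_neqE_nat)
    show "\<not> E n 0" for n by (simp add: E_def halted_def)
    show "decidable X (\<lambda>z. E (pfst z) (psnd z))" for X
      unfolding E_def halted_def by (intro computable_intros decidable_converges)
  qed
  then show thesis by (rule that)
qed

theorem theorem1p2:
  fixes D :: "nat set"
  assumes "computably_enumerable D"
    and "\<not> computable_set {} D"
  shows "\<exists>L A. computable_language L \<and> computable_structure {} L A \<and>
           computably_categorical_relative D L A \<and> \<not> computably_categorical L A"
proof -
  obtain E where "enumeration D E"
    using assms(1) by (rule computably_enumerable_enumeration)
  then interpret enumeration D E .
  show ?thesis
    using computable_unary_language computable_pairs[OF decidable_const]
      categorical_relative not_categorical[OF assms(2)] by blast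
qed

end
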